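(* Let $G$ be a finite abelian $2$-group. Then the prime order element graph $\Gamma(G)$ is integral, i.e. all eigenvalues of the adjacency matrix of $\Gamma(G)$ are integers.
   Context: For a finite group $G$, the prime order element graph $\Gamma(G)$ is the simple undirected graph with vertex set $G$ in which two distinct vertices $x,y\in G$ are adjacent if and only if the order of the product $xy$ is a prime number. A graph is called integral if all the eigenvalues of its adjacency matrix are integers. *)

theory Defs
  imports
    "HOL-Algebra.Multiplicative_Group"
    "HOL-Computational_Algebra.Primes"
    "Graph_Theory.Pair_Digraph"
    "Jordan_Normal_Form.Char_Poly"
begin

text \<open>Simple undirected graphs are the symmetric loopfree pair digraphs (locale
  \<open>pair_graph\<close>): an edge is represented by its two arcs.\<close>

definition prime_order_element_graph :: "('a, 'b) monoid_scheme \<Rightarrow> 'a pair_pre_digraph" where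
  "prime_order_element_graph G =
     \<lparr> pverts = carrier G,
       parcs = {(x, y). x \<in> carrier G \<and> y \<in> carrier G \<and> x \<noteq> y \<and>
                        prime (group.ord G (x \<otimes>\<^bsub>G\<^esub> y))} \<rparr>"

text \<open>Adjacency is symmetric also for nonabelian groups, since \<open>x y\<close> and \<open>y x\<close> are
  conjugate.\<close>

lemma (in group) ord_mult_commute:
  assumes "x \<in> carrier G" "y \<in> carrier G"
  shows "ord (x \<otimes> y) = ord (y \<otimes> x)"
proof -
  have one: "(b \<otimes> a) [^] n = \<one>"
    if ab: "a \<in> carrier G" "b \<in> carrier G" and n: "(a \<otimes> b) [^] n = \<one>" for a b and n :: nat
  proof -
    have "a \<otimes> (b \<otimes> a) [^] n = (a \<otimes> b) [^] n \<otimes> a"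
    proof (induction n)
      case 0
      then show ?case using ab by simp
    next
      case (Suc n)
      have "a \<otimes> (b \<otimes> a) [^] Suc n = a \<otimes> (b \<otimes> a) [^] n \<otimes> (b \<otimes> a)"
        using ab by (simp add: m_assoc)
      also have "\<dots> = (a \<otimes> b) [^] Suc n \<otimes> a"
        using ab by (simp add: Suc m_assoc)
      finally show ?case .
    qed
    then show ?thesis using ab n by simp
  qed
  have "ord (b \<otimes> a) dvd ord (a \<otimes> b)" if "a \<in> carrier G" "b \<in> carrier G" for a b
    using that one[OF that pow_ord_eq_1] pow_eq_id by simp
  then show ?thesis
    using assms by (intro dvd_antisym)
qed

lemma pair_graph_prime_order_element_graph:
  assumes "group G" "finite (carrier G)"
  shows "pair_graph (prime_order_element_graph G)"
proof -
  have "finite (parcs (prime_order_element_graph G))"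
    by (rule finite_subset[of _ "carrier G \<times> carrier G"])
       (auto simp: prime_order_element_graph_def assms)
  moreover have "sym (parcs (prime_order_element_graph G))"
    using group.ord_mult_commute[OF assms(1)]
    by (auto simp: prime_order_element_graph_def sym_def)
  ultimately show ?thesis
    using assms(2)
    by unfold_locales
       (auto simp: prime_order_element_graph_def symmetric_def arcs_ends_def arc_to_ends_def)
qed

text \<open>Matrices are indexed by \<open>{0..<n}\<close>, so the adjacency matrix is taken with respect to an
  enumeration \<open>vs\<close> of the vertices.\<close>

definition adjacency_matrix :: "'a pair_pre_digraph \<Rightarrow> 'a list \<Rightarrow> complex mat" where
  "adjacency_matrix \<Gamma> vs =
     mat (length vs) (length vs) (\<lambda>(i, j). if (vs ! i, vs ! j) \<in> parcs \<Gamma> then 1 else 0)"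

text \<open>Different enumerations give matrices conjugate by a permutation matrix, so the universal
  quantifier over \<open>vs\<close> involves no choice. It is vacuous for infinite vertex sets; the notion
  is meant for finite graphs.\<close>

definition integral_graph :: "'a pair_pre_digraph \<Rightarrow> bool" where
  "integral_graph \<Gamma> \<longleftrightarrow>
     (\<forall>vs. distinct vs \<and> set vs = pverts \<Gamma> \<longrightarrow>
        (\<forall>k. eigenvalue (adjacency_matrix \<Gamma> vs) k \<longrightarrow> k \<in> \<int>))"

end

theory Submission
  imports Defs
begin

text \<open>In a \<open>2\<close>-group the prime order elements are the involutions, so \<open>x\<close> is adjacent to the
  \<open>y\<close> with \<open>y\<^sup>2 = x\<^sup>-\<^sup>2\<close>, except \<open>y = x\<^sup>-\<^sup>1\<close> and \<open>y = x\<close>. Let \<open>f\<close> be an eigenfunction for \<open>k\<close>,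
  let \<open>F x\<close> be the sum of \<open>f\<close> over all \<open>y\<close> with \<open>y\<^sup>2 = x\<^sup>-\<^sup>2\<close>, let \<open>m\<close> be the number of these \<open>y\<close>,
  and let \<open>d x\<close> be \<open>1\<close> if \<open>x\<close> has order \<open>4\<close> and \<open>0\<close> otherwise. Then
  \<open>(k + d x) f x = F x - f x\<^sup>-\<^sup>1\<close>. As \<open>d\<close> and \<open>F\<close> depend only on the square of their
  argument, summation yields \<open>(k + d x) F x = (m - 1) F x\<^sup>-\<^sup>1\<close>. Applying these equations to
  \<open>x\<close> and \<open>x\<^sup>-\<^sup>1\<close> gives \<open>(k + d x)\<^sup>2 = (m - 1)\<^sup>2\<close> for some \<open>x\<close> if \<open>F\<close> is nonzero, and
  \<open>(k + d x)\<^sup>2 = 1\<close> for some \<open>x\<close> if \<open>F = 0\<close>.\<close>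

text \<open>As \<open>vs\<close> is distinct, each vertex has one position, so an eigenvector
  becomes a function on vertices and each row of the eigenvalue equation a sum over
  neighbours.\<close>

lemma eigenvalue_adjacency_matrixE:
  assumes "eigenvalue (adjacency_matrix \<Gamma> vs) k" and "distinct vs"
  obtains f x where "x \<in> set vs" "f x \<noteq> 0"
    "\<And>x. x \<in> set vs \<Longrightarrow> k * f x = (\<Sum>y | y \<in> set vs \<and> (x, y) \<in> parcs \<Gamma>. f y)"
proof -
  let ?n = "length vs" and ?A = "adjacency_matrix \<Gamma> vs"
  have bij: "bij_betw ((!) vs) {0..<?n} (set vs)"
    using assms(2) by (intro bij_betw_nth) auto
  obtain v where v: "v \<in> carrier_vec ?n" "v \<noteq> 0\<^sub>v ?n" "?A *\<^sub>v v = k \<cdot>\<^sub>v v"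
    using assms(1) by (auto simp: eigenvalue_def eigenvector_def adjacency_matrix_def)
  define f where "f x = v $ the_inv_into {0..<?n} ((!) vs) x" for x
  have f: "f (vs ! i) = v $ i" if "i < ?n" for i
    using that bij by (simp add: f_def the_inv_into_f_f bij_betw_def)
  obtain i where i: "i < ?n" "v $ i \<noteq> 0"
    using v(1,2) by (metis carrier_vecD eq_vecI index_zero_vec)
  have "k * f x = (\<Sum>y | y \<in> set vs \<and> (x, y) \<in> parcs \<Gamma>. f y)" if x: "x \<in> set vs" for x
  proof -
    obtain i where i: "i < ?n" "x = vs ! i"
      using x by (auto simp: in_set_conv_nth)
    have "k * f x = (?A *\<^sub>v v) $ i"
      using v i by (simp add: f)
    also have "\<dots> = (\<Sum>j = 0..<?n. if (x, vs ! j) \<in> parcs \<Gamma> then f (vs ! j) else 0)"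
      using v(1) i
      by (auto simp: adjacency_matrix_def scalar_prod_def f intro!: sum.cong)
    also have "\<dots> = (\<Sum>y\<in>set vs. if (x, y) \<in> parcs \<Gamma> then f y else 0)"
      by (rule sum.reindex_bij_betw[OF bij])
    also have "\<dots> = (\<Sum>y | y \<in> set vs \<and> (x, y) \<in> parcs \<Gamma>. f y)"
      by (simp add: sum.inter_filter)
    finally show ?thesis .
  qed
  with i f that[of "vs ! i" f] show thesis
    by simp
qed

text \<open>A prime dividing \<open>ord x\<close> divides a power of 2, hence is 2.\<close>

lemma (in group) prime_ord_iff_of_order_power_2:
  assumes "Coset.order G = 2 ^ n" and "x \<in> carrier G"
  shows "prime (ord x) \<longleftrightarrow> x \<otimes> x = \<one> \<and> x \<noteq> \<one>"
proof -
  have "prime (ord x) \<longleftrightarrow> ord x = 2"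
  proof
    assume p: "prime (ord x)"
    then have "ord x dvd 2"
      using ord_dvd_group_order[OF assms(2)] unfolding assms(1) by (rule prime_dvd_power)
    with p show "ord x = 2"
      by (intro primes_dvd_imp_eq two_is_prime_nat)
  qed simp
  moreover have "x [^] (2::nat) = x \<otimes> x"
    using assms(2) by (simp add: numeral_2_eq_2)
  then have "x \<otimes> x = \<one> \<longleftrightarrow> ord x dvd 2"
    using pow_eq_id[OF assms(2), of 2] by (simp only:)
  moreover have "ord x dvd 2 \<longleftrightarrow> ord x = 1 \<or> ord x = 2"
    using prime_nat_iff two_is_prime_nat by auto
  ultimately show ?thesis
    using ord_eq_1[OF assms(2)] by auto
qed

text \<open>Substituting one equation into the other gives \<open>a * a * u = b * b * u\<close>, and
  \<open>u\<close> cancels. It serves for \<open>u\<close> and \<open>v\<close> the values of one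
  function at \<open>x\<close> and \<open>inv x\<close>.\<close>

lemma eq_or_eq_minus_of_swap:
  fixes a b u v :: "'a :: idom"
  assumes "a * u = b * v" "a * v = b * u" "u \<noteq> 0"
  shows "a = b \<or> a = - b"
proof -
  have "a\<^sup>2 * u = b\<^sup>2 * u"
    using assms(1,2) by (metis mult.assoc mult.left_commute power2_eq_square)
  with assms(3) show ?thesis
    by (simp add: power2_eq_iff)
qed

lemma (in comm_group) eigenfunction_imp_Ints:
  fixes f :: "'a \<Rightarrow> 'c :: idom"
  assumes fin: "finite (carrier G)"
    and x0: "x0 \<in> carrier G" "f x0 \<noteq> 0"
    and eigen: "\<And>x. x \<in> carrier G \<Longrightarrow>
      k * f x = (\<Sum>y | y \<in> carrier G \<and> x \<noteq> y \<and> (x \<otimes> y) \<otimes> (x \<otimes> y) = \<one> \<and> x \<otimes> y \<noteq> \<one>. f y)"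
  shows "k \<in> \<int>"
proof -
  define N where "N x = {y \<in> carrier G. y \<otimes> y = inv (x \<otimes> x)}" for x
  define F where "F x = sum f (N x)" for x
  \<comment> \<open>For \<open>x\<close> in the group the condition says
    \<open>x \<in> N x - {inv x}\<close>: exactly then does excluding \<open>y = x\<close> remove a
    further term.\<close>
  define d :: "'a \<Rightarrow> 'c" where
    "d x = (if x \<otimes> x = inv (x \<otimes> x) \<and> x \<otimes> x \<noteq> \<one> then 1 else 0)" for x
  have finN: "finite (N x)" for x
    using fin by (simp add: N_def)
  have sq_inv: "inv x \<otimes> inv x = inv (x \<otimes> x)" if "x \<in> carrier G" for x
    using that by (simp add: inv_mult)
  have inv_N: "inv x \<in> N x" if "x \<in> carrier G" for x
    using that by (simp add: N_def sq_inv)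
  have d_inv: "d (inv x) = d x" if "x \<in> carrier G" for x
    using that by (auto simp: d_def sq_inv)
  \<comment> \<open>Members of \<open>N x\<close> have the same square as \<open>inv x\<close>, not
    as \<open>x\<close>; this is why \<open>F_eq\<close> relates \<open>F x\<close> to
    \<open>F (inv x)\<close>.\<close>
  have N_const: "N y = N (inv x)" "d y = d x" if "x \<in> carrier G" "y \<in> N x" for x y
    using that d_inv[of x] by (auto simp: N_def d_def sq_inv)
  have prod_sq: "(x \<otimes> y) \<otimes> (x \<otimes> y) = \<one> \<longleftrightarrow> y \<otimes> y = inv (x \<otimes> x)"
    if "x \<in> carrier G" "y \<in> carrier G" for x y
  proof -
    have "(x \<otimes> y) \<otimes> (x \<otimes> y) = (y \<otimes> y) \<otimes> (x \<otimes> x)"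
      using that by (simp add: m_ac)
    then show ?thesis
      using that inv_equality[of "y \<otimes> y" "x \<otimes> x"] by (metis l_inv m_closed)
  qed
  have prod_one: "x \<otimes> y = \<one> \<longleftrightarrow> y = inv x" if "x \<in> carrier G" "y \<in> carrier G" for x y
    using that by (metis inv_equality m_comm r_inv)
  have f_eq: "(k + d x) * f x = F x - f (inv x)" if x: "x \<in> carrier G" for x
  proof -
    have "{y. y \<in> carrier G \<and> x \<noteq> y \<and> (x \<otimes> y) \<otimes> (x \<otimes> y) = \<one> \<and> x \<otimes> y \<noteq> \<one>}
        = N x - {inv x} - {x}"
      using x prod_sq[OF x] prod_one[OF x] by (auto simp: N_def)
    then have "k * f x = sum f (N x - {inv x} - {x})"
      using eigen[OF x] by simp
    also have "\<dots> = F x - f (inv x) - (if x \<in> N x - {inv x} then f x else 0)"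
      using inv_N[OF x] finN by (simp add: F_def sum_diff1)
    also have "(if x \<in> N x - {inv x} then f x else 0) = d x * f x"
      using x prod_one[of x x] by (auto simp: N_def d_def)
    finally show ?thesis
      by (simp add: algebra_simps)
  qed
  have bij: "bij_betw (\<lambda>y. inv y) (N x) (N (inv x))" if "x \<in> carrier G" for x
    using that by (intro bij_betwI[where g = "\<lambda>y. inv y"]) (auto simp: N_def sq_inv)
  have F_eq: "(k + d x) * F x = (of_nat (card (N x)) - 1) * F (inv x)" if x: "x \<in> carrier G" for x
  proof -
    have "(k + d x) * F x = (\<Sum>y\<in>N x. (k + d y) * f y)"
      using N_const(2)[OF x] by (simp add: F_def sum_distrib_left)
    also have "\<dots> = (\<Sum>y\<in>N x. F (inv x) - f (inv y))"
      using N_const(1)[OF x] by (intro sum.cong) (auto simp: f_eq F_def N_def)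
    also have "\<dots> = of_nat (card (N x)) * F (inv x) - (\<Sum>y\<in>N x. f (inv y))"
      by (simp add: sum_subtractf)
    also have "(\<Sum>y\<in>N x. f (inv y)) = F (inv x)"
      unfolding F_def by (rule sum.reindex_bij_betw[OF bij[OF x]])
    finally show ?thesis
      by (simp add: algebra_simps)
  qed
  have d_Ints: "d x \<in> \<int>" for x
    by (simp add: d_def)
  have *: "k \<in> \<int>" if "k + d x = b \<or> k + d x = - b" "b \<in> \<int>" for x b
    using that d_Ints[of x] by (metis Ints_diff Ints_minus add_diff_cancel_right')
  show ?thesis
  proof (cases "\<exists>x\<in>carrier G. F x \<noteq> 0")
    case True
    then obtain x where x: "x \<in> carrier G" "F x \<noteq> 0"
      by blast
    \<comment> \<open>Inversion preserves \<open>d\<close> and the size of \<open>N\<close>, so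
      \<open>F_eq\<close> has the same two coefficients at \<open>x\<close> and at
      \<open>inv x\<close>.\<close>
    have "card (N (inv x)) = card (N x)"
      using bij_betw_same_card[OF bij[OF x(1)]] by simp
    then have "(k + d x) * F (inv x) = (of_nat (card (N x)) - 1) * F x"
      using F_eq[of "inv x"] x(1) by (simp add: d_inv)
    from eq_or_eq_minus_of_swap[OF F_eq[OF x(1)] this x(2)] show ?thesis
      by (rule *) simp
  next
    case False
    \<comment> \<open>With \<open>F\<close> zero, \<open>f_eq\<close> at \<open>x0\<close> and
      \<open>inv x0\<close> is itself a swapped pair, now with \<open>b = -1\<close>.\<close>
    then have "(k + d x0) * f x0 = (- 1) * f (inv x0)" "(k + d x0) * f (inv x0) = (- 1) * f x0"
      using f_eq[of x0] f_eq[of "inv x0"] x0(1) by (simp_all add: d_inv)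
    from eq_or_eq_minus_of_swap[OF this x0(2)] show ?thesis
      by (rule *) simp
  qed
qed

theorem theorem2p1:
  fixes G :: "('a, 'b) monoid_scheme" (structure)
  assumes "comm_group G"
    and "finite (carrier G)"
    and "\<exists>n::nat. Coset.order G = 2 ^ n"
  shows "integral_graph (prime_order_element_graph G)"
proof -
  interpret comm_group G
    by (rule assms(1))
  obtain n :: nat where n: "Coset.order G = 2 ^ n"
    using assms(3) by blast
  note prime_iff = prime_ord_iff_of_order_power_2[OF n]
  have "k \<in> \<int>"
    if vs: "distinct vs" "set vs = carrier G"
      and k: "eigenvalue (adjacency_matrix (prime_order_element_graph G) vs) k" for vs k
  proof -
    obtain f x0 where f: "x0 \<in> carrier G" "f x0 \<noteq> 0"
      "\<And>x. x \<in> carrier G \<Longrightarrow>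
        k * f x = (\<Sum>y | y \<in> carrier G \<and> (x, y) \<in> parcs (prime_order_element_graph G). f y)"
      using eigenvalue_adjacency_matrixE[OF k vs(1)] unfolding vs(2) by blast
    have "{y. y \<in> carrier G \<and> (x, y) \<in> parcs (prime_order_element_graph G)} =
        {y. y \<in> carrier G \<and> x \<noteq> y \<and> (x \<otimes> y) \<otimes> (x \<otimes> y) = \<one> \<and> x \<otimes> y \<noteq> \<one>}"
      if "x \<in> carrier G" for x
      using that by (auto simp: prime_order_element_graph_def prime_iff)
    with f(3) show ?thesis
      by (intro eigenfunction_imp_Ints[where f = f and k = k, OF assms(2) f(1,2)]) simp
  qed
  moreover have "pverts (prime_order_element_graph G) = carrier G"
    by (simp add: prime_order_element_graph_def)
  ultimately show ?thesis
    unfolding integral_graph_def by auto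
qed

end
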